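(* Let $m\ge1$ be an integer and let $(T_t)_{t\ge0}$ be an $m$-isometric semigroup on a complex Hilbert space $\mathcal H$. Then there exists $w\ge0$ such that $$\|T_t\|\le e^{wt},\quad t\ge0,$$ i.e. $(T_t)_{t\ge0}$ is quasicontractive with parameter $w$.
   Context: A bounded operator $T$ on $\mathcal H$ is $m$-isometric if $\sum_{k=0}^m(-1)^{m-k}\binom mk\|T^kx\|^2=0$ for all $x\in\mathcal H$. An $m$-isometric semigroup is a $C_0$-semigroup $(T_t)_{t\ge0}$ such that each $T_t$ is $m$-isometric. *)

theory Defs
  imports "HOL-Analysis.Analysis"
begin

text \<open>
  Complex Hilbert spaces. The real vector space structure, norm and completeness come from
  \<^class>\<open>banach\<close>; the complex scalar multiplication extends the real one, and the norm is
  the one induced by the inner product (linear in its first argument). Positivity and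
  definiteness of the inner product already follow from the last axiom and the norm axioms;
  they are kept so that the list is the textbook one.
\<close>

class complex_hilbert_space = banach +
  fixes scaleC :: "complex \<Rightarrow> 'a \<Rightarrow> 'a" (infixr \<open>*\<^sub>C\<close> 75)
    and cinner :: "'a \<Rightarrow> 'a \<Rightarrow> complex"
  assumes scaleC_add_right: "a *\<^sub>C (x + y) = a *\<^sub>C x + a *\<^sub>C y"
    and scaleC_add_left: "(a + b) *\<^sub>C x = a *\<^sub>C x + b *\<^sub>C x"
    and scaleC_scaleC: "a *\<^sub>C (b *\<^sub>C x) = (a * b) *\<^sub>C x"
    and scaleR_scaleC: "r *\<^sub>R x = complex_of_real r *\<^sub>C x"
    and cinner_commute: "cinner x y = cnj (cinner y x)"
    and cinner_add_left: "cinner (x + y) z = cinner x z + cinner y z"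
    and cinner_scaleC_left: "cinner (a *\<^sub>C x) y = a * cinner x y"
    and cinner_ge_zero: "0 \<le> Re (cinner x x)"
    and cinner_eq_zero_iff: "cinner x x = 0 \<longleftrightarrow> x = 0"
    and norm_eq_sqrt_cinner: "norm x = sqrt (Re (cinner x x))"

instantiation complex :: complex_hilbert_space
begin

definition scaleC_complex :: "complex \<Rightarrow> complex \<Rightarrow> complex"
  where "scaleC_complex a x = a * x"

definition cinner_complex :: "complex \<Rightarrow> complex \<Rightarrow> complex"
  where "cinner_complex x y = x * cnj y"

instance
  by standard
    (simp_all add: scaleC_complex_def cinner_complex_def algebra_simps scaleR_conv_of_real
      cmod_def power2_eq_square)

end

definition bounded_clinear :: "('a::complex_hilbert_space \<Rightarrow> 'b::complex_hilbert_space) \<Rightarrow> bool"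
  where "bounded_clinear f \<longleftrightarrow> bounded_linear f \<and> (\<forall>a x. f (a *\<^sub>C x) = a *\<^sub>C f x)"

definition m_isometric :: "nat \<Rightarrow> ('a::complex_hilbert_space \<Rightarrow> 'a) \<Rightarrow> bool"
  where "m_isometric m T \<longleftrightarrow> bounded_clinear T \<and>
    (\<forall>x. (\<Sum>k=0..m. (-1) ^ (m - k) * real (m choose k) * (norm ((T ^^ k) x))\<^sup>2) = 0)"

text \<open>
  A semigroup is a function on all of \<^typ>\<open>real\<close> of which only the values at nonnegative
  times matter.
\<close>

definition C0_semigroup :: "(real \<Rightarrow> 'a::complex_hilbert_space \<Rightarrow> 'a) \<Rightarrow> bool"
  where "C0_semigroup T \<longleftrightarrow>
    (\<forall>t\<ge>0. bounded_clinear (T t)) \<and>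
    T 0 = id \<and>
    (\<forall>s\<ge>0. \<forall>t\<ge>0. T (s + t) = T s \<circ> T t) \<and>
    (\<forall>x. ((\<lambda>t. T t x) \<longlongrightarrow> x) (at_right 0))"

definition m_isometric_semigroup :: "nat \<Rightarrow> (real \<Rightarrow> 'a::complex_hilbert_space \<Rightarrow> 'a) \<Rightarrow> bool"
  where "m_isometric_semigroup m T \<longleftrightarrow> C0_semigroup T \<and> (\<forall>t\<ge>0. m_isometric m (T t))"

definition quasicontractive :: "real \<Rightarrow> (real \<Rightarrow> 'a::complex_hilbert_space \<Rightarrow> 'a) \<Rightarrow> bool"
  where "quasicontractive w T \<longleftrightarrow> (\<forall>t\<ge>0. onorm (T t) \<le> exp (w * t))"

end

theory Submission
  imports Defs "HOL-Computational_Algebra.Polynomial"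
begin

text \<open>
  For fixed \<open>x\<close> the function \<open>f t = \<parallel>T\<^sub>t x\<parallel>\<^sup>2\<close> has vanishing \<open>m\<close>-th differences for every step, so on
  each grid \<open>\<nat>/N\<close> it agrees with a Newton interpolation polynomial. All these polynomials coincide
  on \<open>\<nat>\<close>, hence are equal, and right continuity makes \<open>f\<close> a single polynomial on \<open>[0,\<infinity>)\<close>:
  \<open>f t = (\<Sum>j<m. (t gchoose j) * \<Delta>\<^sup>j f 0)\<close>. The coefficients are combinations of
  \<open>\<parallel>T\<^sub>k x\<parallel>\<^sup>2\<close> with \<open>k < m\<close>, so they are \<open>O(\<parallel>x\<parallel>\<^sup>2)\<close>, while the constant term is exactly
  \<open>\<parallel>x\<parallel>\<^sup>2\<close>; this gives \<open>f t \<le> (1 + C t e\<^bsup>mt\<^esup>) \<parallel>x\<parallel>\<^sup>2 \<le> e\<^bsup>(C+m)t\<^esup> \<parallel>x\<parallel>\<^sup>2\<close>.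
\<close>

section \<open>Finite differences\<close>

definition fdiff :: "(nat \<Rightarrow> 'a::ab_group_add) \<Rightarrow> nat \<Rightarrow> 'a"
  where "fdiff a n = a (Suc n) - a n"

lemma funpow_fdiff_Suc: "(fdiff ^^ Suc j) a n = (fdiff ^^ j) a (Suc n) - (fdiff ^^ j) a n"
  by (simp add: fdiff_def)

text \<open>For \<open>a k\<close> the squared norm of the \<open>k\<close>-th iterate of
  \<open>T\<close> at \<open>x\<close>, the right-hand side at \<open>n = 0\<close> is the sum in
  \<open>m_isometric\<close>. The induction step is Pascal's rule.\<close>

lemma funpow_fdiff_eq_sum:
  fixes a :: "nat \<Rightarrow> 'a::comm_ring_1"
  shows "(fdiff ^^ j) a n = (\<Sum>k\<le>j. (-1) ^ (j - k) * of_nat (j choose k) * a (n + k))"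
proof (induction j arbitrary: n)
  case 0
  then show ?case by simp
next
  case (Suc j)
  \<comment> \<open>Subtraction on \<open>nat\<close> truncates at \<open>k = j\<close>, so the sign
    does not flip there; the binomial coefficient is zero instead.\<close>
  have flip: "(-1) ^ (j - Suc k) * of_nat (j choose Suc k) * a (n + Suc k)
      = - ((-1) ^ (j - k) * of_nat (j choose Suc k) * a (n + Suc k))" if "k \<le> j" for k
  proof (cases "k = j")
    case False
    with that have "j - k = Suc (j - Suc k)" by simp
    then show ?thesis by simp
  qed (simp add: binomial_eq_0)
  have "(\<Sum>k\<le>j. (-1) ^ (j - k) * of_nat (j choose k) * a (n + k))
      = (\<Sum>k\<le>Suc j. (-1) ^ (j - k) * of_nat (j choose k) * a (n + k))"
    by (simp add: binomial_eq_0)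
  also have "\<dots> = (-1) ^ j * a n - (\<Sum>k\<le>j. (-1) ^ (j - k) * of_nat (j choose Suc k) * a (n + Suc k))"
    by (subst sum.atMost_Suc_shift) (simp add: flip sum_negf del: add_Suc_right)
  finally have shift: "(\<Sum>k\<le>j. (-1) ^ (j - k) * of_nat (j choose k) * a (n + k))
      = (-1) ^ j * a n - (\<Sum>k\<le>j. (-1) ^ (j - k) * of_nat (j choose Suc k) * a (n + Suc k))" .
  have "(\<Sum>k\<le>Suc j. (-1) ^ (Suc j - k) * of_nat (Suc j choose k) * a (n + k))
      = (\<Sum>k\<le>j. (-1) ^ (j - k) * of_nat (j choose k) * a (Suc n + k))
        - ((-1) ^ j * a n - (\<Sum>k\<le>j. (-1) ^ (j - k) * of_nat (j choose Suc k) * a (n + Suc k)))"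
    by (subst sum.atMost_Suc_shift) (simp add: algebra_simps sum.distrib)
  then show ?case
    unfolding funpow_fdiff_Suc Suc.IH shift by simp
qed

lemma funpow_fdiff_eq_0:
  assumes "\<And>n. (fdiff ^^ m) a n = 0" and "m \<le> j"
  shows "(fdiff ^^ j) a n = 0"
  using assms(2) by (induction j arbitrary: n rule: dec_induct) (simp_all add: assms(1) fdiff_def)

text \<open>Induction with \<open>a\<close> arbitrary: the hypothesis is used for both
  \<open>a\<close> and \<open>fdiff a\<close>, and Pascal's rule merges the two sums.\<close>

lemma newton_forward_difference:
  fixes a :: "nat \<Rightarrow> 'a::comm_ring_1"
  shows "a n = (\<Sum>j\<le>n. of_nat (n choose j) * (fdiff ^^ j) a 0)"
proof (induction n arbitrary: a)
  case 0
  then show ?case by simp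
next
  case (Suc n)
  have "a (Suc n) = a n + fdiff a n"
    by (simp add: fdiff_def)
  also have "\<dots> = (\<Sum>j\<le>Suc n. of_nat (n choose j) * (fdiff ^^ j) a 0)
      + (\<Sum>j\<le>n. of_nat (n choose j) * (fdiff ^^ Suc j) a 0)"
    using Suc.IH[of a] Suc.IH[of "fdiff a"] by (simp add: funpow_swap1 binomial_eq_0)
  also have "\<dots> = (\<Sum>j\<le>Suc n. of_nat (Suc n choose j) * (fdiff ^^ j) a 0)"
    by (simp only: sum.atMost_Suc_shift) (simp add: algebra_simps sum.distrib)
  finally show ?case .
qed

lemma newton_forward_difference_truncated:
  fixes a :: "nat \<Rightarrow> 'a::comm_ring_1"
  assumes "\<And>n. (fdiff ^^ m) a n = 0"
  shows "a n = (\<Sum>j<m. of_nat (n choose j) * (fdiff ^^ j) a 0)"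
proof -
  have "a n = (\<Sum>j\<le>n. of_nat (n choose j) * (fdiff ^^ j) a 0)"
    by (rule newton_forward_difference)
  also have "\<dots> = (\<Sum>j\<in>{..n} \<union> {..<m}. of_nat (n choose j) * (fdiff ^^ j) a 0)"
    by (rule sum.mono_neutral_left) (auto simp: binomial_eq_0)
  also have "\<dots> = (\<Sum>j<m. of_nat (n choose j) * (fdiff ^^ j) a 0)"
    by (rule sum.mono_neutral_right) (auto simp: funpow_fdiff_eq_0[OF assms])
  finally show ?thesis .
qed

text \<open>The point is uniformity: \<open>C\<close> may depend on \<open>j\<close> and
  \<open>n\<close> but not on \<open>x\<close>. Later \<open>x\<close> is a vector and
  \<open>g x\<close> its squared norm.\<close>

lemma funpow_fdiff_family_bound:
  fixes a :: "'i \<Rightarrow> nat \<Rightarrow> real"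
  assumes "\<And>k. \<exists>C. \<forall>x. \<bar>a x k\<bar> \<le> C * g x"
  shows "\<exists>C. \<forall>x. \<bar>(fdiff ^^ j) (a x) n\<bar> \<le> C * g x"
proof (induction j arbitrary: n)
  case 0
  then show ?case by (simp add: assms)
next
  case (Suc j)
  obtain C1 C2 where "\<And>x. \<bar>(fdiff ^^ j) (a x) (Suc n)\<bar> \<le> C1 * g x"
    and "\<And>x. \<bar>(fdiff ^^ j) (a x) n\<bar> \<le> C2 * g x"
    using Suc.IH[of "Suc n"] Suc.IH[of n] by blast
  then have "\<bar>(fdiff ^^ Suc j) (a x) n\<bar> \<le> (C1 + C2) * g x" for x
    unfolding funpow_fdiff_Suc distrib_right by (smt (verit))
  then show ?case by blast
qed

section \<open>Functions with vanishing differences\<close>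

text \<open>The factor \<open>c\<close> will be \<open>N\<close>, which rescales the grid of step
  \<open>1/N\<close> to the integers.\<close>

lemma gbinomial_poly_exists:
  fixes c :: "'a::field_char_0"
  shows "\<exists>p. \<forall>t. poly p t = (c * t) gchoose j"
proof
  show "\<forall>t. poly (smult (1 / fact j) (\<Prod>i = 0..<j. [:- of_nat i, c:])) t = (c * t) gchoose j"
    by (simp add: gbinomial_prod_rev poly_prod mult.commute)
qed

lemma gbinomial_combination_poly:
  fixes c :: "'a::field_char_0"
  shows "\<exists>p. \<forall>t. poly p t = (\<Sum>j<m. ((c * t) gchoose j) * b j)"
proof -
  obtain q where "\<And>j t. poly (q j) t = (c * t) gchoose j"
    using gbinomial_poly_exists by metis
  then have "poly (\<Sum>j<m. smult (b j) (q j)) t = (\<Sum>j<m. ((c * t) gchoose j) * b j)" for t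
    by (simp add: poly_sum mult.commute)
  then show ?thesis by blast
qed

lemma poly_eqI_nat:
  fixes p q :: "'a::{idom, ring_char_0} poly"
  assumes "\<And>n. poly p (of_nat n) = poly q (of_nat n)"
  shows "p = q"
proof (rule ccontr)
  assume "p \<noteq> q"
  then have "finite {x. poly (p - q) x = 0}"
    by (intro poly_roots_finite) simp
  then have "finite (range (of_nat :: nat \<Rightarrow> 'a))"
    by (rule rev_finite_subset) (auto simp: assms)
  then show False
    using finite_imageD inj_of_nat by blast
qed

lemma vanishing_differences_imp_newton:
  fixes f :: "real \<Rightarrow> real"
  assumes diff0: "\<And>h n. 0 < h \<Longrightarrow> (fdiff ^^ m) (\<lambda>k. f (real k * h)) n = 0"
    and rcont: "\<And>t. 0 \<le> t \<Longrightarrow> (f \<longlongrightarrow> f t) (at_right t)"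
    and "0 \<le> t"
  shows "f t = (\<Sum>j<m. (t gchoose j) * (fdiff ^^ j) (\<lambda>k. f (real k)) 0)"
proof -
  define b where "b N j = (fdiff ^^ j) (\<lambda>k. f (real k * (1 / real N))) 0" for N j
  have "\<forall>N. \<exists>p. \<forall>t. poly p t = (\<Sum>j<m. ((real N * t) gchoose j) * b N j)"
    by (intro allI gbinomial_combination_poly)
  from choice[OF this]
  obtain p where p: "\<And>N t. poly (p N) t = (\<Sum>j<m. ((real N * t) gchoose j) * b N j)"
    by blast
  have grid: "f (real k / real N) = poly (p N) (real k / real N)" if "N > 0" for N k
    using newton_forward_difference_truncated[of m "\<lambda>k. f (real k * (1 / real N))" k]
      diff0[of "1 / real N"] that
    by (simp add: p b_def binomial_gbinomial)
  \<comment> \<open>The integer \<open>n\<close> is the grid point \<open>(n * N) / N\<close>, so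
    both polynomials take the value of \<open>f\<close> there.\<close>
  have same: "p N = p 1" if "N > 0" for N
  proof (rule poly_eqI_nat)
    fix n
    show "poly (p N) (real n) = poly (p 1) (real n)"
      using grid[OF that, of "n * N"] grid[of 1 n] that by simp
  qed
  have rat: "f (real k / real N) = poly (p 1) (real k / real N)" if "N > 0" for N k
    using grid[OF that] unfolding same[OF that] .
  \<comment> \<open>A disagreement at \<open>t\<close> would persist on some interval to the right
    of \<open>t\<close> by right continuity, yet that interval contains a nonnegative
    rational.\<close>
  have "f t = poly (p 1) t"
  proof (rule ccontr)
    assume "f t \<noteq> poly (p 1) t"
    moreover have "((\<lambda>s. f s - poly (p 1) s) \<longlongrightarrow> f t - poly (p 1) t) (at_right t)"
      by (intro tendsto_intros rcont) (use \<open>0 \<le> t\<close> in auto)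
    ultimately have "\<forall>\<^sub>F s in at_right t. f s - poly (p 1) s \<noteq> 0"
      by (intro tendsto_imp_eventually_ne) auto
    then obtain c where "c > t" and c: "\<And>s. t < s \<Longrightarrow> s < c \<Longrightarrow> f s \<noteq> poly (p 1) s"
      unfolding eventually_at_right_field by auto
    obtain r where r: "r \<in> \<rat>" "t < r" "r < c"
      using Rats_dense_in_real[OF \<open>c > t\<close>] by blast
    then obtain k N :: nat where "N \<noteq> 0" "\<bar>r\<bar> = real k / real N"
      using Rats_abs_nat_div_natE by metis
    then show False
      using rat[of N k] c[OF r(2,3)] r(2) \<open>0 \<le> t\<close> by simp
  qed
  then show ?thesis
    by (simp add: p b_def)
qed

text \<open>The leading factor \<open>t\<close> makes the bound vanish at \<open>t = 0\<close>; each
  further factor of the product costs at most \<open>exp t\<close>.\<close>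

lemma abs_gbinomial_le:
  fixes t :: real
  assumes "0 \<le> t" and "1 \<le> j"
  shows "\<bar>t gchoose j\<bar> \<le> t * exp (real j * t)"
proof -
  obtain i where j: "j = Suc i"
    using assms(2) by (cases j) auto
  have factor: "\<bar>(t - real k) / real k\<bar> \<le> exp t" if "1 \<le> k" for k
  proof -
    have "\<bar>t - real k\<bar> \<le> real k + t * real k"
      using that assms(1) mult_left_mono[of 1 "real k" t] by simp
    also have "\<dots> \<le> exp t * real k"
      using exp_ge_add_one_self[of t] mult_right_mono[of "1 + t" "exp t" "real k"]
      by (simp add: algebra_simps)
    finally show ?thesis
      using that by (simp add: divide_le_eq)
  qed
  have bound: "\<bar>t gchoose Suc i\<bar> \<le> t * exp (real i * t)"
  proof (induction i)
    case 0
    then show ?case using assms(1) by simp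
  next
    case (Suc i)
    have "t gchoose Suc (Suc i) = (t gchoose Suc i) * ((t - real (Suc i)) / real (Suc (Suc i)))"
      by (simp add: gbinomial_prod_rev field_simps)
    \<comment> \<open>The denominator is lowered by one so that \<open>factor\<close>
      applies.\<close>
    also have "\<bar>\<dots>\<bar> \<le> \<bar>t gchoose Suc i\<bar> * \<bar>(t - real (Suc i)) / real (Suc i)\<bar>"
      unfolding abs_mult by (intro mult_left_mono) (auto simp: field_simps)
    also have "\<dots> \<le> (t * exp (real i * t)) * exp t"
      using Suc.IH factor[of "Suc i"] assms(1) by (intro mult_mono) auto
    finally show ?case
      by (simp add: algebra_simps exp_add)
  qed
  also have "\<dots> \<le> t * exp (real j * t)"
    using assms(1) by (intro mult_left_mono) (auto simp: j algebra_simps)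
  finally show ?thesis by (simp add: j)
qed

section \<open>The orbits of an m-isometric semigroup\<close>

context
  fixes T :: "real \<Rightarrow> 'a::complex_hilbert_space \<Rightarrow> 'a"
  assumes sg: "C0_semigroup T"
begin

lemma semigroup_bounded_linear: "0 \<le> t \<Longrightarrow> bounded_linear (T t)"
  using sg by (simp add: C0_semigroup_def bounded_clinear_def)

lemma semigroup_zero: "T 0 x = x"
  using sg by (simp add: C0_semigroup_def)

lemma semigroup_add: "0 \<le> s \<Longrightarrow> 0 \<le> t \<Longrightarrow> T (s + t) x = T s (T t x)"
  using sg by (simp add: C0_semigroup_def)

lemma semigroup_funpow: "0 \<le> h \<Longrightarrow> (T h ^^ k) x = T (real k * h) x"
  by (induction k) (simp_all add: semigroup_zero distrib_right flip: semigroup_add)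

text \<open>Strong continuity at \<open>0\<close> is applied to the vector \<open>T t x\<close> and
  shifted by the semigroup law.\<close>

lemma semigroup_right_continuous:
  assumes "0 \<le> t"
  shows "((\<lambda>s. T s x) \<longlongrightarrow> T t x) (at_right t)"
proof -
  have "((\<lambda>h. T h (T t x)) \<longlongrightarrow> T t x) (at_right 0)"
    using sg by (simp add: C0_semigroup_def)
  then have "((\<lambda>h. T (h + t) x) \<longlongrightarrow> T t x) (at_right 0)"
    by (rule Lim_transform_eventually)
      (auto simp: eventually_at_filter assms semigroup_add)
  then show ?thesis
    by (simp add: filterlim_at_right_to_0[of _ _ t])
qed

lemma norm_sq_newton:
  assumes iso: "\<And>t. 0 \<le> t \<Longrightarrow> m_isometric m (T t)" and "0 \<le> t"
  shows "(norm (T t x))\<^sup>2 = (\<Sum>j<m. (t gchoose j) * (fdiff ^^ j) (\<lambda>k. (norm (T (real k) x))\<^sup>2) 0)"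
proof (rule vanishing_differences_imp_newton)
  fix h :: real and n :: nat
  assume "0 < h"
  \<comment> \<open>The difference at index \<open>n\<close> is the isometry identity of
    \<open>T h\<close> at the vector \<open>T (real n * h) x\<close>.\<close>
  have "T (real (n + k) * h) x = (T h ^^ k) (T (real n * h) x)" for k
    using \<open>0 < h\<close> by (simp add: semigroup_funpow add.commute distrib_right flip: semigroup_add)
  then show "(fdiff ^^ m) (\<lambda>k. (norm (T (real k * h) x))\<^sup>2) n = 0"
    unfolding funpow_fdiff_eq_sum
    using iso[of h] \<open>0 < h\<close> by (simp add: m_isometric_def atLeast0AtMost)
next
  fix s :: real
  assume "0 \<le> s"
  then show "((\<lambda>t. (norm (T t x))\<^sup>2) \<longlongrightarrow> (norm (T s x))\<^sup>2) (at_right s)"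
    by (intro tendsto_intros semigroup_right_continuous)
qed fact

lemma norm_sq_exp_bound:
  assumes iso: "\<And>t. 0 \<le> t \<Longrightarrow> m_isometric m (T t)" and "1 \<le> m"
  obtains v where "0 \<le> v" and "\<And>t x. 0 \<le> t \<Longrightarrow> (norm (T t x))\<^sup>2 \<le> exp (v * t) * (norm x)\<^sup>2"
proof -
  define d where "d x j = (fdiff ^^ j) (\<lambda>k. (norm (T (real k) x))\<^sup>2) 0" for x j
  have "\<exists>C. \<forall>x. \<bar>(norm (T (real k) x))\<^sup>2\<bar> \<le> C * (norm x)\<^sup>2" for k
  proof -
    have "(norm (T (real k) x))\<^sup>2 \<le> (onorm (T (real k)))\<^sup>2 * (norm x)\<^sup>2" for x
      unfolding power_mult_distrib[symmetric]
      by (intro power_mono onorm semigroup_bounded_linear) auto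
    then show ?thesis by auto
  qed
  then have "\<exists>C. \<forall>x. \<bar>d x j\<bar> \<le> C * (norm x)\<^sup>2" for j
    unfolding d_def by (rule funpow_fdiff_family_bound)
  then obtain c where c: "\<And>j x. \<bar>d x j\<bar> \<le> c j * (norm x)\<^sup>2"
    by metis
  \<comment> \<open>The sum starts at \<open>1\<close> because the \<open>j = 0\<close> term is
    exactly the squared norm of \<open>x\<close>. Absolute values are taken since \<open>c j\<close>
    may be negative.\<close>
  define C where "C = (\<Sum>j = 1..<m. \<bar>c j\<bar>)"
  have "C \<ge> 0"
    by (simp add: C_def sum_nonneg)
  have "(norm (T t x))\<^sup>2 \<le> exp ((C + real m) * t) * (norm x)\<^sup>2" if t: "0 \<le> t" for t x
  proof -
    have term_le: "(t gchoose j) * d x j \<le> (t * exp (real m * t)) * (\<bar>c j\<bar> * (norm x)\<^sup>2)"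
      if "j \<in> {1..<m}" for j
    proof -
      have "\<bar>t gchoose j\<bar> \<le> t * exp (real j * t)"
        using that t by (intro abs_gbinomial_le) auto
      also have "\<dots> \<le> t * exp (real m * t)"
        using that t by (intro mult_left_mono) (auto simp: mult_right_mono)
      finally have "\<bar>t gchoose j\<bar> \<le> t * exp (real m * t)" .
      moreover have "\<bar>d x j\<bar> \<le> \<bar>c j\<bar> * (norm x)\<^sup>2"
        using c[of x j] mult_right_mono[OF abs_ge_self zero_le_power2] by (rule order_trans)
      ultimately have "\<bar>t gchoose j\<bar> * \<bar>d x j\<bar> \<le> (t * exp (real m * t)) * (\<bar>c j\<bar> * (norm x)\<^sup>2)"
        using t by (intro mult_mono) auto
      then show ?thesis
        by (metis abs_ge_self abs_mult order_trans)
    qed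
    have "{..<m} = insert 0 {1..<m}"
      using \<open>1 \<le> m\<close> by auto
    then have "(norm (T t x))\<^sup>2 = (norm x)\<^sup>2 + (\<Sum>j = 1..<m. (t gchoose j) * d x j)"
      using norm_sq_newton[OF iso t, of x] by (simp add: d_def semigroup_zero)
    also have "\<dots> \<le> (norm x)\<^sup>2
        + (\<Sum>j = 1..<m. (t * exp (real m * t)) * (\<bar>c j\<bar> * (norm x)\<^sup>2))"
      using term_le by (intro add_left_mono sum_mono) auto
    also have "\<dots> = (1 + C * t * exp (real m * t)) * (norm x)\<^sup>2"
      by (simp add: C_def sum_distrib_left sum_distrib_right algebra_simps)
    also have "\<dots> \<le> exp ((C + real m) * t) * (norm x)\<^sup>2"
    proof (rule mult_right_mono)
      have "1 + C * t * exp (real m * t) \<le> (1 + C * t) * exp (real m * t)"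
        using t by (simp add: distrib_right)
      also have "\<dots> \<le> exp (C * t) * exp (real m * t)"
        by (intro mult_right_mono exp_ge_add_one_self) auto
      finally show "1 + C * t * exp (real m * t) \<le> exp ((C + real m) * t)"
        by (simp add: exp_add distrib_right)
    qed simp
    finally show ?thesis .
  qed
  then show thesis
    using that[of "C + real m"] \<open>C \<ge> 0\<close> by simp
qed

end

theorem corollary3p5:
  fixes m :: nat and T :: "real \<Rightarrow> 'a::complex_hilbert_space \<Rightarrow> 'a"
  assumes "m \<ge> 1"
    and "m_isometric_semigroup m T"
  shows "\<exists>w\<ge>0. quasicontractive w T"
proof -
  have sg: "C0_semigroup T" and iso: "\<And>t. 0 \<le> t \<Longrightarrow> m_isometric m (T t)"
    using assms(2) by (auto simp: m_isometric_semigroup_def)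
  obtain v where "0 \<le> v"
    and v: "\<And>t x. 0 \<le> t \<Longrightarrow> (norm (T t x))\<^sup>2 \<le> exp (v * t) * (norm x)\<^sup>2"
    using norm_sq_exp_bound[OF sg iso assms(1)] by blast
  \<comment> \<open>The exponent is halved because \<open>v\<close> bounds squared norms.\<close>
  have "onorm (T t) \<le> exp (v / 2 * t)" if "0 \<le> t" for t
  proof (rule onorm_bound)
    fix x
    have "exp (v * t) = (exp (v / 2 * t))\<^sup>2"
      by (simp flip: exp_double)
    then have "(norm (T t x))\<^sup>2 \<le> (exp (v / 2 * t) * norm x)\<^sup>2"
      using v[OF that, of x] by (simp add: power_mult_distrib)
    then show "norm (T t x) \<le> exp (v / 2 * t) * norm x"
      by (rule power2_le_imp_le) simp
  qed simp
  then show ?thesis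
    using \<open>0 \<le> v\<close> by (intro exI[of _ "v / 2"]) (simp add: quasicontractive_def)
qed

end
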